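(* Let $n\ge 2$, let $b\in\{1,-1\}$, let $c\ge 0$ and $d$ be real numbers with $\lambda=c-d\neq 0$, and let $Q$ be the real symmetric $n\times n$ tridiagonal matrix with $Q_{11}=Q_{nn}=d$, $Q_{ii}=c$ for $2\le i\le n-1$, $Q_{i,i+1}=Q_{i+1,i}=-b$ for $1\le i\le n-1$, and all other entries $0$. Suppose $Q$ is invertible. If $c\neq 2$, then $\operatorname{tr}(Q^{-2})=(\kappa_0^2\kappa^2)^{-1}\mathcal{S}$, where $$\begin{aligned}\mathcal{S}&=4\rho^2n^2-8\rho n(\lambda^2-1)+4\rho(1+\lambda^2)+\frac{nc(\varphi_+^4r_+^{2n-2}-\varphi_-^4r_-^{2n-2})}{\kappa_0}+2(\lambda^2-1)^2\\&\quad+\frac{16\rho^2}{\kappa_0^2}-\frac{4\rho c(\varphi_+^2r_+^{2n-1}+\varphi_-^2r_-^{2n-1})}{\kappa_0^2}+\frac{2(\lambda^2-1)(\varphi_+^2r_+^{2n-1}-\varphi_-^2r_-^{2n-1})}{\kappa_0}.\end{aligned}$$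
   Context: For $c\ne 2$: $r_\pm=(c\pm\sqrt{c^2-4})/2$ (complex numbers if $c<2$, with $\sqrt{c^2-4}=\mathrm{i}\sqrt{4-c^2}$), $\varphi_\pm=r_\pm-\lambda$, $\kappa_0=\varphi_+-\varphi_-=r_+-r_-$, $\kappa=\varphi_+^2r_+^{n-1}-\varphi_-^2r_-^{n-1}$, and $\rho=\varphi_+\varphi_-=1-c\lambda+\lambda^2$. $Q^{-2}$ denotes $(Q^{-1})^2$. *)

theory Defs
  imports Complex_Main "Jordan_Normal_Form.Gauss_Jordan_Elimination"
begin

(* Matrix indices run over 0, ..., n - 1. *)
definition Q_mat :: "nat \<Rightarrow> real \<Rightarrow> real \<Rightarrow> real \<Rightarrow> real mat" where
  "Q_mat n b c d = mat n n (\<lambda>(i, j).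
     if i = j then (if i = 0 \<or> i = n - 1 then d else c)
     else if j = i + 1 \<or> i = j + 1 then - b
     else 0)"

definition mat_trace :: "'a :: comm_monoid_add mat \<Rightarrow> 'a" where
  "mat_trace A = (\<Sum>i<dim_row A. A $$ (i, i))"

(* csqrt is the principal root: it is sqrt (c^2 - 4) for c > 2 and
   i sqrt (4 - c^2) for 0 <= c < 2, see the two lemmas below. *)
definition r_plus :: "real \<Rightarrow> complex" where
  "r_plus c = (complex_of_real c + csqrt (complex_of_real (c\<^sup>2 - 4))) / 2"

definition r_minus :: "real \<Rightarrow> complex" where
  "r_minus c = (complex_of_real c - csqrt (complex_of_real (c\<^sup>2 - 4))) / 2"

lemma csqrt_disc_ge_2:
  assumes "c \<ge> 2"
  shows "csqrt (complex_of_real (c\<^sup>2 - 4)) = complex_of_real (sqrt (c\<^sup>2 - 4))"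
proof -
  have "c\<^sup>2 \<ge> 2\<^sup>2" using assms by (intro power_mono) auto
  then show ?thesis by (subst csqrt_of_real_nonneg) auto
qed

lemma csqrt_disc_less_2:
  assumes "0 \<le> c" "c < 2"
  shows "csqrt (complex_of_real (c\<^sup>2 - 4)) = \<i> * complex_of_real (sqrt (4 - c\<^sup>2))"
proof -
  have "c\<^sup>2 \<le> 2\<^sup>2" using assms by (intro power_mono) auto
  then have "csqrt (complex_of_real (c\<^sup>2 - 4)) = \<i> * complex_of_real (sqrt \<bar>c\<^sup>2 - 4\<bar>)"
    by (subst csqrt_of_real_nonpos) auto
  moreover have "\<bar>c\<^sup>2 - 4\<bar> = 4 - c\<^sup>2" using \<open>c\<^sup>2 \<le> 2\<^sup>2\<close> by simp
  ultimately show ?thesis by simp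
qed

definition phi_plus :: "real \<Rightarrow> real \<Rightarrow> complex" where
  "phi_plus c lam = r_plus c - complex_of_real lam"

definition phi_minus :: "real \<Rightarrow> real \<Rightarrow> complex" where
  "phi_minus c lam = r_minus c - complex_of_real lam"

definition kappa0 :: "real \<Rightarrow> real \<Rightarrow> complex" where
  "kappa0 c lam = phi_plus c lam - phi_minus c lam"

lemma kappa0_eq: "kappa0 c lam = r_plus c - r_minus c"
  by (simp add: kappa0_def phi_plus_def phi_minus_def)

definition kappa :: "nat \<Rightarrow> real \<Rightarrow> real \<Rightarrow> complex" where
  "kappa n c lam =
     (phi_plus c lam)\<^sup>2 * r_plus c ^ (n - 1) - (phi_minus c lam)\<^sup>2 * r_minus c ^ (n - 1)"

definition rho :: "real \<Rightarrow> real \<Rightarrow> complex" where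
  "rho c lam = phi_plus c lam * phi_minus c lam"

lemma rho_eq: "rho c lam = complex_of_real (1 - c * lam + lam\<^sup>2)"
proof -
  have *: "(csqrt (complex_of_real (c\<^sup>2 - 4)))\<^sup>2 = (complex_of_real c)\<^sup>2 - 4"
    by simp
  have "rho c lam = ((complex_of_real c / 2 - complex_of_real lam)\<^sup>2
      - (csqrt (complex_of_real (c\<^sup>2 - 4)))\<^sup>2 / 4)"
    unfolding rho_def phi_plus_def phi_minus_def r_plus_def r_minus_def
    by (simp add: field_simps power2_eq_square del: of_real_diff of_real_power of_real_mult power2_csqrt)
  also have "\<dots> = complex_of_real (1 - c * lam + lam\<^sup>2)"
    unfolding * by (simp add: field_simps power2_eq_square)
  finally show ?thesis .
qed

definition S_sum :: "nat \<Rightarrow> real \<Rightarrow> real \<Rightarrow> complex" where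
  "S_sum n c lam = (
     let rp = r_plus c; rm = r_minus c;
         \<phi>p = phi_plus c lam; \<phi>m = phi_minus c lam;
         \<kappa>0 = kappa0 c lam; \<rho> = rho c lam;
         N = of_nat n; C = complex_of_real c; L = complex_of_real lam
     in 4 * \<rho>\<^sup>2 * N\<^sup>2 - 8 * \<rho> * N * (L\<^sup>2 - 1) + 4 * \<rho> * (1 + L\<^sup>2)
        + N * C * (\<phi>p ^ 4 * rp ^ (2 * n - 2) - \<phi>m ^ 4 * rm ^ (2 * n - 2)) / \<kappa>0
        + 2 * (L\<^sup>2 - 1)\<^sup>2
        + 16 * \<rho>\<^sup>2 / \<kappa>0\<^sup>2
        - 4 * \<rho> * C * (\<phi>p\<^sup>2 * rp ^ (2 * n - 1) + \<phi>m\<^sup>2 * rm ^ (2 * n - 1)) / \<kappa>0\<^sup>2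
        + 2 * (L\<^sup>2 - 1) * (\<phi>p\<^sup>2 * rp ^ (2 * n - 1) - \<phi>m\<^sup>2 * rm ^ (2 * n - 1)) / \<kappa>0)"

end

theory Submission
  imports Defs
begin

text \<open>
  Write \<open>m = n - 1\<close> and let \<open>w\<close> solve \<open>w\<^bsub>k+2\<^esub> = c w\<^bsub>k+1\<^esub> - w\<^bsub>k\<^esub>\<close>, \<open>w\<^bsub>0\<^esub> = 1\<close>, \<open>w\<^bsub>1\<^esub> = d\<close>, so that
  \<open>\<kappa>\<^bsub>0\<^esub> w\<^bsub>k\<^esub> = \<phi>\<^bsub>+\<^esub> r\<^bsub>+\<^esub>\<^bsup>k\<^esup> - \<phi>\<^bsub>-\<^esub> r\<^bsub>-\<^esub>\<^bsup>k\<^esup>\<close>. By the symmetry of \<open>Q\<close> under reversal, \<open>w\<^bsub>k\<^esub>\<close> and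
  \<open>w\<^bsub>m-k\<^esub>\<close> satisfy the left and the right boundary condition, so the inverse of \<open>Q\<close> is the
  Green matrix with entries \<open>b\<^bsup>i+j\<^esup> w\<^bsub>min i j\<^esub> w\<^bsub>m - max i j\<^esub> / D\<close>, where the Wronskian \<open>D\<close>
  equals \<open>\<kappa> / \<kappa>\<^bsub>0\<^esub>\<close>. The sum of the squares of these entries is
  \<open>(C\<^bsub>m\<^esub> + 2 (C\<^bsub>0\<^esub> + \<dots> + C\<^bsub>m-1\<^esub>)) / D\<^sup>2\<close> for the self-convolution \<open>C\<close> of \<open>w\<^sup>2\<close>. Its increment
  \<open>C\<^bsub>m+1\<^esub> + C\<^bsub>m\<^esub>\<close> is a combination of geometric sums that can be evaluated without dividing by
  \<open>c\<close> (each \<open>C\<^bsub>m\<^esub>\<close> alone cannot), and it agrees with the increment of \<open>S\<close>.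
\<close>

section \<open>Ring identities under \<open>x*y = 1\<close>: mixed power sums, increment and initial
  value of the numerator\<close>

text \<open>Each sum times \<open>x^2 - y^2\<close> is a difference of powers. Adding two neighbours
  brings out the factor \<open>x + y\<close> because \<open>x*y = 1\<close>, so only
  \<open>x - y\<close> is left as a denominator. Induction avoids cancelling \<open>x + y\<close>,
  which may be zero.\<close>

lemma mixed_power_sum_Suc_add:
  fixes x y :: "'a::comm_ring_1"
  assumes "x*y=1"
  shows "(x - y) * ((\<Sum>i\<le>Suc m. (x\<^sup>2)^i * (y\<^sup>2)^(Suc m - i)) + (\<Sum>i\<le>m. (x\<^sup>2)^i * (y\<^sup>2)^(m - i)))
    = x^(2*m+3) - y^(2*m+3)"
proof -
  have xy': "x * (y * z) = z" for z using assms by (simp flip: mult.assoc)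
  note P = power2_eq_square power3_eq_cube power4_eq_xxxx algebra_simps assms xy'
  define E where "E m = (\<Sum>i\<le>m. (x\<^sup>2)^i * (y\<^sup>2)^(m - i))" for m
  have E_Suc: "E (Suc m) = (x\<^sup>2)^Suc m + y\<^sup>2 * E m" for m
  proof -
    have "(\<Sum>i\<le>m. (x\<^sup>2)^i * (y\<^sup>2)^(Suc m - i)) = y\<^sup>2 * E m"
      unfolding E_def sum_distrib_left
      by (intro sum.cong) (auto simp: Suc_diff_le algebra_simps)
    then show ?thesis by (simp add: E_def)
  qed
  have "(x - y) * (E (Suc m) + E m) = x^(2*m+3) - y^(2*m+3)"
  proof (induction m)
    case 0
    have "E 0 = 1" by (simp add: E_def)
    then have "(x - y) * (E (Suc 0) + E 0) = (x-y)*(x\<^sup>2+y\<^sup>2+1)" unfolding E_Suc by simp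
    also have "\<dots> = x^3-y^3" by (simp add: P)
    finally show ?case by simp
  next
    case (Suc m)
    define X where "X = x^(2*m)"
    define Y where "Y = y^(2*m)"
    have e: "x^(2*m+3) = X*x^3" "y^(2*m+3) = Y*y^3" "x^(2*Suc m+3) = X*x^5" "y^(2*Suc m+3) = Y*y^5"
      "(x\<^sup>2)^Suc (Suc m) = X*x^4" "(x\<^sup>2)^Suc m = X*x^2"
      by (simp_all add: X_def Y_def power_add power_mult numeral_eq_Suc algebra_simps)
    have "(x - y) * (E (Suc (Suc m)) + E (Suc m)) = (x - y) * (X*x^4 + X*x^2) + y^2 * ((x - y) * (E (Suc m) + E m))"
      using E_Suc[of m] E_Suc[of "Suc m"] unfolding e by (simp add: algebra_simps)
    also have "\<dots> = X*x^5 - Y*y^5"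
      unfolding Suc.IH e by (simp add: P numeral_eq_Suc)
    finally show ?case unfolding e .
  qed
  then show ?thesis unfolding E_def .
qed

text \<open>Compares the terms carrying \<open>X\<close> in \<open>S_poly_increment\<close>;
  exchanging \<open>x\<close> and \<open>y\<close> gives those carrying \<open>Y\<close>.\<close>

lemma S_poly_increment_coeff:
  fixes x y L N :: "'a::comm_ring_1"
  assumes xy: "x * y = 1" and r: "r = (x-L)*(y-L)"
  shows "(x-y)*(N+1)*(x+y)*(x-L)^4*x^2 - (x-y)*N*(x+y)*(x-L)^4 + (2*(x-y)*(L^2-1)*(x-L)^2*x - 4*r*(x+y)*(x-L)^2*x)*(x^2-1)
   = (x-y)^2*((N+1)*(x-L)^4*x^2+N*(x-L)^4) + 2*r^2*(x-y)*x^3 - 4*r*(x-L)^2*(x-y)*y*(x^2+x^4)"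
proof -
  have xy': "x * (y * z) = z" for z using xy by (simp flip: mult.assoc)
  note P = power2_eq_square power3_eq_cube power4_eq_xxxx algebra_simps xy xy'
  define a where "a = (x-L)^2"
  have a: "(x-L)^4 = a^2" unfolding a_def by (simp flip: power_mult)
  \<comment> \<open>Used to replace the factor \<open>(y-L)^2\<close> of \<open>r^2\<close>, so that
    the final comparison can treat \<open>a\<close> and \<open>r\<close> as atoms.\<close>
  have 1: "(y-L)^2*x = (x-L)^2*y + (x-y)*(L^2-1)" by (simp add: P)
  have 2: "x^2 - 1 = x*(x-y)" "y*(x^2+x^4) = x+x^3" by (simp_all add: P)
  have 3: "2*r^2*x^3 = 2*(x-L)^2*((x-L)^2*y + (x-y)*(L^2-1))*x^2"
    unfolding r 1[symmetric] by (simp add: P)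
  have "(x-y)*(N+1)*(x+y)*(x-L)^4*x^2 - (x-y)*N*(x+y)*(x-L)^4 + (2*(x-y)*(L^2-1)*(x-L)^2*x - 4*r*(x+y)*(x-L)^2*x)*(x*(x-y))
   = (x-y)^2*((N+1)*(x-L)^4*x^2+N*(x-L)^4) + (2*(x-L)^2*((x-L)^2*y + (x-y)*(L^2-1))*x^2)*(x-y) - 4*r*(x-L)^2*(x-y)*(x+x^3)"
    unfolding a a_def[symmetric] by (simp add: P)
  then show ?thesis unfolding 2(1) 3[symmetric] 2(2)[symmetric] by (simp add: ac_simps)
qed

text \<open>
  \<open>\<kappa>\<^bsub>0\<^esub>\<^sup>2 S\<close> with \<open>x = r\<^bsub>+\<^esub>\<close>, \<open>y = r\<^bsub>-\<^esub>\<close>, \<open>L = \<lambda>\<close>, and with \<open>N\<close>, \<open>X\<close>, \<open>Y\<close> standing for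
  \<open>n\<close>, \<open>r\<^bsub>+\<^esub>\<^bsup>2n-2\<^esup>\<close>, \<open>r\<^bsub>-\<^esub>\<^bsup>2n-2\<^esup>\<close>.
\<close>
definition S_poly :: "'a::comm_ring_1 \<Rightarrow> 'a \<Rightarrow> 'a \<Rightarrow> 'a \<Rightarrow> 'a \<Rightarrow> 'a \<Rightarrow> 'a" where
  "S_poly x y L N X Y = (let r = (x-L)*(y-L) in
     (x-y)^2*(4 * r\<^sup>2 * N\<^sup>2 - 8 * r * N * (L\<^sup>2 - 1) + 4 * r * (1 + L\<^sup>2)+ 2 * (L\<^sup>2 - 1)\<^sup>2)
        + (x-y)*N * (x+y) * ((x-L) ^ 4 * X - (y-L) ^ 4 * Y)
        + 16 * r\<^sup>2
        - 4 * r * (x+y) * ((x-L)\<^sup>2 * X*x + (y-L)\<^sup>2 * Y*y)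
        + 2 * (x-y)*(L\<^sup>2 - 1) * ((x-L)\<^sup>2 * X*x - (y-L)\<^sup>2 * Y*y))"

text \<open>Intended for \<open>N = m + 1\<close>, \<open>X = x^(2*m)\<close>,
  \<open>Y = y^(2*m)\<close>. \<open>G\<close> and \<open>G'\<close> stand for the sums of
  \<open>x^(2*i)\<close> up to \<open>m\<close> and \<open>m + 1\<close>, \<open>H\<close> and
  \<open>H'\<close> for those in \<open>y\<close>, and \<open>F\<close> for the sum of two
  neighbouring mixed sums. They are given by their multiples with \<open>x - y\<close>, so nothing
  is divided. The claim follows by comparing the parts with \<open>X\<close>, with \<open>Y\<close>
  and with neither.\<close>

lemma S_poly_increment:
  fixes x y L :: "'a::comm_ring_1"
  assumes "x*y=1"
    and "(x-y)*G = y*(X*x^2-1)" and "(x-y)*G' = y*(X*x^4-1)"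
    and "(x-y)*H = - (x*(Y*y^2-1))" and "(x-y)*H' = - (x*(Y*y^4-1))"
    and "(x-y)*F = X*x^3-Y*y^3"
    and r: "r = (x-L)*(y-L)"
  shows "S_poly x y L (N+1) (X*x^2) (Y*y^2) - S_poly x y L N X Y = (x-y)^2*
   ((N+1)*((x-L)^4*X*x^2 + (y-L)^4*Y*y^2+4*r^2) + N*((x-L)^4*X + (y-L)^4*Y+4*r^2) + 2*r^2*F
   - 4*r*((x-L)^2*(G+G')+(y-L)^2*(H+H')))" (is "_ = ?R")
proof -
  have xy': "x * (y * z) = z" for z using \<open>x*y=1\<close> by (simp flip: mult.assoc)
  note P = power2_eq_square power3_eq_cube power4_eq_xxxx algebra_simps \<open>x*y=1\<close> xy'
  define A where "A = (x-L)^4"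
  define B where "B = (y-L)^4"
  define a where "a = (x-L)^2"
  define b where "b = (y-L)^2"
  note d = A_def[symmetric] B_def[symmetric] a_def[symmetric] b_def[symmetric]
  have cX: "(x-y)*(N+1)*(x+y)*A*x^2 - (x-y)*N*(x+y)*A + (2*(x-y)*(L^2-1)*a*x - 4*r*(x+y)*a*x)*(x^2-1)
   = (x-y)^2*((N+1)*A*x^2+N*A) + 2*r^2*(x-y)*x^3 - 4*r*a*(x-y)*y*(x^2+x^4)"
   unfolding A_def a_def by (rule S_poly_increment_coeff) fact+
  have cY: "(y-x)*(N+1)*(y+x)*B*y^2 - (y-x)*N*(y+x)*B + (2*(y-x)*(L^2-1)*b*y - 4*r*(y+x)*b*y)*(y^2-1)
   = (y-x)^2*((N+1)*B*y^2+N*B) + 2*r^2*(y-x)*y^3 - 4*r*b*(y-x)*x*(y^2+y^4)"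
    unfolding B_def b_def by (rule S_poly_increment_coeff) (use assms in \<open>simp_all add: mult.commute\<close>)
  have c1: "b*x - a*y = (x-y)*(L^2-1)" unfolding a_def b_def by (simp add: P)
  have "?R = (x-y)^2*((N+1)*(A*X*x^2 + B*Y*y^2+4*r^2) + N*(A*X + B*Y+4*r^2)) + 2*r^2*(x-y)*((x-y)*F)
    - 4*r*(x-y)*(a*((x-y)*G+(x-y)*G')+b*((x-y)*H+(x-y)*H'))" unfolding d by (simp add: power2_eq_square algebra_simps)
  also have "\<dots> = (x-y)^2*((N+1)*(A*X*x^2 + B*Y*y^2+4*r^2) + N*(A*X + B*Y+4*r^2)) + 2*r^2*(x-y)*(X*x^3-Y*y^3)
    - 4*r*(x-y)*(a*(y*(X*x^2-1)+y*(X*x^4-1))+b*(- (x*(Y*y^2-1)) - (x*(Y*y^4-1))))"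
    unfolding assms(2-6) by simp
  also have "\<dots> = X*((x-y)^2*((N+1)*A*x^2+N*A) + 2*r^2*(x-y)*x^3 - 4*r*a*(x-y)*y*(x^2+x^4))
     + Y*((y-x)^2*((N+1)*B*y^2+N*B) + 2*r^2*(y-x)*y^3 - 4*r*b*(y-x)*x*(y^2+y^4))
     + 4*r^2*(x-y)^2*(2*N+1) - 8*r*(x-y)*(b*x-a*y)"
    by (simp add: power2_eq_square algebra_simps)
  also have "\<dots> = S_poly x y L (N+1) (X*x^2) (Y*y^2) - S_poly x y L N X Y"
    unfolding cX[symmetric] cY[symmetric] c1 S_poly_def Let_def r[symmetric] d by (simp add: power2_eq_square algebra_simps)
  finally show ?thesis ..
qed

text \<open>The initial value for the induction on \<open>m\<close>. Suitably grouped, every piece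
  is symmetric in \<open>x\<close> and \<open>y\<close>, hence a polynomial in
  \<open>c = x + y\<close> and \<open>L\<close>; the rest is expansion.\<close>

lemma S_poly_one:
  fixes x y L :: "'a::comm_ring_1"
  assumes "x*y=1"
  shows "S_poly x y L 1 1 1 = (x-y)^6"
proof -
  have xy': "x * (y * z) = z" for z using assms by (simp flip: mult.assoc)
  note P = power2_eq_square power3_eq_cube power4_eq_xxxx algebra_simps assms xy'
  define r where r: "r = (x-L)*(y-L)"
  define c where "c = x + y"
  have k: "(x-y)^2 = c^2-4" unfolding c_def by (simp add: P)
  have rr: "r = 1 - c*L+L^2" unfolding c_def r by (simp add: P)
  have 1: "(x-y)* ((x-L) ^ 4 - (y-L) ^ 4) = (x-y)^2*(c-2*L)*(c^2-2-2*L*c+2*L^2)"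
    unfolding c_def r by (simp add: P)
  have 2: "(x-L)\<^sup>2 *x + (y-L)\<^sup>2 *y = c^3-3*c-2*L*(c^2-2)+L^2*c" unfolding c_def r by (simp add: P)
  have 3: "(x-y)*((x-L)\<^sup>2 *x - (y-L)\<^sup>2 *y) = (x-y)^2*(c^2-1-2*L*c+L^2)" unfolding c_def r by (simp add: P)
  have 6: "(x-y)^6 = ((x-y)^2)^3" by (simp flip: power_mult)
  have "S_poly x y L 1 1 1
    = (x-y)^2*(4 * r\<^sup>2 - 8 * r * (L\<^sup>2 - 1) + 4 * r * (1 + L\<^sup>2)+ 2 * (L\<^sup>2 - 1)\<^sup>2)
        + c*((x-y)* ((x-L) ^ 4 - (y-L) ^ 4) )
        + 16 * r\<^sup>2
        - 4 * r * c * ((x-L)\<^sup>2 *x + (y-L)\<^sup>2 *y)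
        + 2 * (L\<^sup>2 - 1) * ((x-y)*((x-L)\<^sup>2 *x - (y-L)\<^sup>2 *y))" unfolding c_def S_poly_def Let_def r[symmetric] by (simp add: algebra_simps)
  also have "\<dots> = (x-y)^6" unfolding 1 2 3 6 k rr by (simp add: P)
  finally show ?thesis .
qed

section \<open>Convolutions of squares\<close>

text \<open>Since \<open>x^k * y^k = 1\<close>, the square of \<open>u k\<close> is
  \<open>A*x^(2*k) + B*y^(2*k) - 2*r\<close>. The product of two such factors has terms constant in
  \<open>i\<close>, mixed terms and geometric terms; reversing the index merges the last two kinds
  in pairs.\<close>

lemma convolution_squares:
  fixes x y L :: "'a::comm_ring_1" and m :: nat
  assumes xy: "x*y=1" and r: "r = (x-L)*(y-L)"
  defines "u \<equiv> \<lambda>k. (x-L)*x^k-(y-L)*y^k"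
  shows "(\<Sum>i\<le>m. (u i)\<^sup>2 * (u (m-i))\<^sup>2) =
     of_nat (Suc m) * ((x-L)^4*x^(2*m) + (y-L)^4*y^(2*m) + 4*r\<^sup>2)
     + 2*r\<^sup>2*(\<Sum>i\<le>m. (x\<^sup>2)^i * (y\<^sup>2)^(m-i))
     - 4*r*((x-L)\<^sup>2*(\<Sum>i\<le>m. (x\<^sup>2)^i) + (y-L)\<^sup>2*(\<Sum>i\<le>m. (y\<^sup>2)^i))"
proof -
  define A where "A = (x-L)\<^sup>2"
  define B where "B = (y-L)\<^sup>2"
  have AB: "(x-L)^4 = A\<^sup>2" "(y-L)^4 = B\<^sup>2" "r\<^sup>2 = A*B" unfolding A_def B_def r by (simp_all add: power_mult_distrib flip: power_mult)
  have u2: "(u k)\<^sup>2 = A * (x\<^sup>2)^k + B * (y\<^sup>2)^k - 2*r" for k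
  proof -
    have 1: "x^k*y^k = 1" using xy by (metis power_mult_distrib power_one)
    have 2: "x^k*(y^k*z) = z" for z using 1 by (simp flip: mult.assoc)
    have "(u k)\<^sup>2 = A * (x^k)\<^sup>2 + B * (y^k)\<^sup>2 - 2*r" unfolding u_def A_def B_def r by (simp add: power2_eq_square algebra_simps 1 2)
    then show ?thesis by (simp add: power_mult[symmetric] mult.commute)
  qed
  have rev: "(\<Sum>i\<le>m. f (m-i)) = (\<Sum>i\<le>m. f i)" for f :: "nat \<Rightarrow> 'a"
    by (rule sum.reindex_bij_witness[where i="\<lambda>i. m-i" and j="\<lambda>i. m-i"]) auto
  have mix: "(\<Sum>i\<le>m. (y\<^sup>2)^i * (x\<^sup>2)^(m-i)) = (\<Sum>i\<le>m. (x\<^sup>2)^i * (y\<^sup>2)^(m-i))"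
    by (rule sum.reindex_bij_witness[where i="\<lambda>i. m-i" and j="\<lambda>i. m-i"]) (auto simp: mult.commute)
  have "(\<Sum>i\<le>m. (u i)\<^sup>2 * (u (m-i))\<^sup>2) = (\<Sum>i\<le>m. A\<^sup>2*x^(2*m) + B\<^sup>2*y^(2*m) + 4*r\<^sup>2
     + A*B*((x\<^sup>2)^i * (y\<^sup>2)^(m-i)) + A*B*((y\<^sup>2)^i * (x\<^sup>2)^(m-i))
     - 2*r*(A*(x\<^sup>2)^i+B*(y\<^sup>2)^i) - 2*r*(A*(x\<^sup>2)^(m-i)+B*(y\<^sup>2)^(m-i)))"
  proof (intro sum.cong refl)
    fix i assume "i \<in> {..m}"
    then have 1: "(x\<^sup>2)^i * (x\<^sup>2)^(m-i) = x^(2*m)" "(y\<^sup>2)^i * (y\<^sup>2)^(m-i) = y^(2*m)"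
      by (simp_all add: power_mult flip: power_add)
    show "(u i)\<^sup>2 * (u (m-i))\<^sup>2 = A\<^sup>2*x^(2*m) + B\<^sup>2*y^(2*m) + 4*r\<^sup>2
     + A*B*((x\<^sup>2)^i * (y\<^sup>2)^(m-i)) + A*B*((y\<^sup>2)^i * (x\<^sup>2)^(m-i))
     - 2*r*(A*(x\<^sup>2)^i+B*(y\<^sup>2)^i) - 2*r*(A*(x\<^sup>2)^(m-i)+B*(y\<^sup>2)^(m-i))"
      unfolding u2 1[symmetric] by (simp add: power2_eq_square[of A] power2_eq_square[of B] power2_eq_square[of r] algebra_simps)
  qed
  also have "\<dots> = of_nat (Suc m) * (A\<^sup>2*x^(2*m) + B\<^sup>2*y^(2*m) + 4*r\<^sup>2)
     + A*B*(\<Sum>i\<le>m. (x\<^sup>2)^i * (y\<^sup>2)^(m-i)) + A*B*(\<Sum>i\<le>m. (y\<^sup>2)^i * (x\<^sup>2)^(m-i))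
     - 2*r*(A*(\<Sum>i\<le>m. (x\<^sup>2)^i) + B*(\<Sum>i\<le>m. (y\<^sup>2)^i))
     - 2*r*(A*(\<Sum>i\<le>m. (x\<^sup>2)^(m-i)) + B*(\<Sum>i\<le>m. (y\<^sup>2)^(m-i)))"
    by (simp only: sum.distrib sum_subtractf sum_distrib_left[symmetric] sum_constant card_atMost)
      (simp add: algebra_simps)
  also have "\<dots> = of_nat (Suc m) * (A\<^sup>2*x^(2*m) + B\<^sup>2*y^(2*m) + 4*r\<^sup>2)
     + 2*(A*B)*(\<Sum>i\<le>m. (x\<^sup>2)^i * (y\<^sup>2)^(m-i))
     - 4*r*(A*(\<Sum>i\<le>m. (x\<^sup>2)^i) + B*(\<Sum>i\<le>m. (y\<^sup>2)^i))"
    unfolding mix rev[of "\<lambda>i. (x\<^sup>2)^i"] rev[of "\<lambda>i. (y\<^sup>2)^i"] by (simp add: algebra_simps)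
  finally show ?thesis unfolding AB A_def[symmetric] B_def[symmetric] .
qed

text \<open>The diagonal of the index square gives the first convolution. The two open triangles
  contribute equally, and \<open>j\<close> to \<open>m - j\<close> maps the upper one onto
  \<open>i + j < m\<close>, whose antidiagonals are the shorter convolutions.\<close>

lemma sum_min_max_eq_convolutions:
  fixes f :: "nat \<Rightarrow> 'a::comm_ring_1"
  shows "(\<Sum>i\<le>m. \<Sum>j\<le>m. f (min i j) * f (m - max i j)) =
    (\<Sum>i\<le>m. f i * f (m-i)) + 2 * (\<Sum>l<m. \<Sum>i\<le>l. f i * f (l-i))"
proof -
  let ?g = "\<lambda>(i,j). f (min i j) * f (m - max i j)"
  let ?D = "{(i,j). i = j \<and> i \<le> m}" and ?U = "{(i,j). i < j \<and> j \<le> m}" and ?L = "{(i,j). j < i \<and> i \<le> m}"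
  have sub: "?D \<subseteq> {..m}\<times>{..m}" "?U \<subseteq> {..m}\<times>{..m}" "?L \<subseteq> {..m}\<times>{..m}" by auto
  then have fin: "finite ?D" "finite ?U" "finite ?L"
    by (auto intro: finite_subset)
  have "(\<Sum>i\<le>m. \<Sum>j\<le>m. f (min i j) * f (m - max i j)) = sum ?g ({..m}\<times>{..m})"
    by (simp add: sum.cartesian_product)
  also have "{..m}\<times>{..m} = ?D \<union> (?U \<union> ?L)" by auto
  also have "sum ?g (?D \<union> (?U \<union> ?L)) = sum ?g ?D + (sum ?g ?U + sum ?g ?L)"
    using fin by (subst sum.union_disjoint; (subst sum.union_disjoint)?) auto
  also have "sum ?g ?D = (\<Sum>i\<le>m. f i * f (m-i))"
    by (rule sum.reindex_bij_witness[where i="\<lambda>i. (i,i)" and j=fst]) auto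
  also have "sum ?g ?L = sum ?g ?U"
    by (rule sum.reindex_bij_witness[where i=prod.swap and j=prod.swap]) (auto simp: min_def max_def)
  also have "sum ?g ?U = (\<Sum>(i,j)\<in>{(i,j). i+j<m}. f i * f j)"
    by (rule sum.reindex_bij_witness[where i="\<lambda>(i,j). (i,m-j)" and j="\<lambda>(i,j). (i,m-j)"]) (auto simp: min_def max_def)
  finally show ?thesis by (simp add: sum.triangle_reindex)
qed


text \<open>Induction on \<open>m\<close>: the bracket grows by \<open>C (Suc m) + C m\<close>,
  which \<open>S_poly_increment\<close> matches with the growth of \<open>S_poly\<close>.\<close>

lemma convolution_sum_closed_form:
  fixes x y L :: "'a::comm_ring_1" and m :: nat
  assumes xy: "x*y=1"
  defines "u \<equiv> \<lambda>k. (x-L)*x^k-(y-L)*y^k"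
  defines "C \<equiv> \<lambda>m. \<Sum>i\<le>m. (u i)\<^sup>2 * (u (m-i))\<^sup>2"
  shows "(x-y)\<^sup>2 * (C m + 2 * (\<Sum>l<m. C l)) = S_poly x y L (of_nat (Suc m)) (x^(2*m)) (y^(2*m))"
proof (induction m)
  case 0
  have "C 0 = (x-y)^4" by (simp add: C_def u_def power2_eq_square power4_eq_xxxx)
  then have "(x-y)\<^sup>2 * (C 0 + 2 * (\<Sum>l<0. C l)) = (x-y)^6" by (simp flip: power_add)
  then show ?case using S_poly_one[OF xy, of L] by simp
next
  case (Suc m)
  define r where "r = (x-L)*(y-L)"
  define G where "G m = (\<Sum>i\<le>m. (x\<^sup>2)^i)" for m
  define H where "H m = (\<Sum>i\<le>m. (y\<^sup>2)^i)" for m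
  define E where "E m = (\<Sum>i\<le>m. (x\<^sup>2)^i * (y\<^sup>2)^(m-i))" for m
  have C: "C m = of_nat (Suc m) * ((x-L)^4*x^(2*m) + (y-L)^4*y^(2*m) + 4*r\<^sup>2)
     + 2*r\<^sup>2*E m - 4*r*((x-L)\<^sup>2*G m + (y-L)\<^sup>2*H m)" for m
    unfolding C_def u_def E_def G_def H_def by (rule convolution_squares[OF xy r_def])
  \<comment> \<open>With \<open>q\<close> inverse to \<open>p\<close>, the usual denominator
    \<open>1 - p^2\<close> becomes \<open>p - q\<close> up to the factor \<open>-q\<close>.\<close>
  have geo: "(p-q) * (\<Sum>i\<le>m. (p\<^sup>2)^i) = q * (p^(2*m)*p^2 - 1)" if "p*q=1" for p q :: 'a and m
  proof -
    have "(1 - p\<^sup>2) * (\<Sum>i\<le>m. (p\<^sup>2)^i) = 1 - (p\<^sup>2)^Suc m" by (rule sum_gp_basic)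
    moreover have "p - q = - (q * (1 - p\<^sup>2))" using that by (simp add: power2_eq_square algebra_simps)
    ultimately have "(p-q) * (\<Sum>i\<le>m. (p\<^sup>2)^i) = - (q * (1 - (p\<^sup>2)^Suc m))"
      by (simp only: mult.assoc mult_minus_left)
    then show ?thesis unfolding power_mult by (simp add: algebra_simps)
  qed
  have yx: "y*x=1" using xy by (simp add: mult.commute)
  have "S_poly x y L (of_nat (Suc m) + 1) (x^(2*m)*x^2) (y^(2*m)*y^2) - S_poly x y L (of_nat (Suc m)) (x^(2*m)) (y^(2*m))
    = (x-y)^2*
   ((of_nat (Suc m)+1)*((x-L)^4*x^(2*m)*x^2 + (y-L)^4*y^(2*m)*y^2+4*r^2) + of_nat (Suc m)*((x-L)^4*x^(2*m) + (y-L)^4*y^(2*m)+4*r^2) + 2*r^2*(E (Suc m) + E m)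
   - 4*r*((x-L)^2*(G m+G (Suc m))+(y-L)^2*(H m+H (Suc m))))"
  proof (rule S_poly_increment[OF xy _ _ _ _ _ r_def])
    show "(x-y) * G m = y * (x^(2*m)*x^2 - 1)" unfolding G_def by (rule geo[OF xy])
    show "(x-y) * G (Suc m) = y * (x^(2*m)*x^4 - 1)" unfolding G_def geo[OF xy]
      by (simp add: power4_eq_xxxx power2_eq_square ac_simps)
    have "(y-x) * H m = x * (y^(2*m)*y^2 - 1)" unfolding H_def by (rule geo[OF yx])
    then show "(x-y) * H m = - (x * (y^(2*m)*y^2 - 1))" by (metis minus_diff_eq mult_minus_left)
    have "(y-x) * H (Suc m) = x * (y^(2*m)*y^4 - 1)" unfolding H_def geo[OF yx]
      by (simp add: power4_eq_xxxx power2_eq_square ac_simps)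
    then show "(x-y) * H (Suc m) = - (x * (y^(2*m)*y^4 - 1))" by (metis minus_diff_eq mult_minus_left)
    show "(x-y) * (E (Suc m) + E m) = x^(2*m)*x^3 - y^(2*m)*y^3"
      unfolding E_def mixed_power_sum_Suc_add[OF xy] by (simp add: power_add)
  qed
  also have "\<dots> = (x-y)^2*(C (Suc m) + C m)"
    unfolding C by (simp add: power2_eq_square algebra_simps)
  finally have "S_poly x y L (of_nat (Suc (Suc m))) (x^(2*Suc m)) (y^(2*Suc m)) =
     (x-y)^2*(C (Suc m) + C m) + (x-y)\<^sup>2 * (C m + 2 * (\<Sum>l<m. C l))"
    unfolding Suc.IH by (simp add: algebra_simps power2_eq_square)
  then show ?case by (simp add: algebra_simps)
qed

section \<open>The Green matrix and the inverse of \<open>Q\<close>\<close>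

text \<open>The sequence \<open>w\<close> of the overview. For \<open>b*b = 1\<close> and
  \<open>k < n\<close>, its value at \<open>k\<close> is the leading principal minor of order
  \<open>k\<close> of \<open>Q_mat n b c d\<close>.\<close>

fun boundary_sol :: "real \<Rightarrow> real \<Rightarrow> nat \<Rightarrow> real" where
  "boundary_sol c d 0 = 1"
| "boundary_sol c d (Suc 0) = d"
| "boundary_sol c d (Suc (Suc k)) = c * boundary_sol c d (Suc k) - boundary_sol c d k"

text \<open>For \<open>m \<ge> 1\<close> and \<open>b*b = 1\<close> this is the determinant of
  \<open>Q_mat (Suc m) b c d\<close>, expanded along the last row.\<close>

definition Q_det :: "nat \<Rightarrow> real \<Rightarrow> real \<Rightarrow> real" where
  "Q_det m c d = d * boundary_sol c d m - boundary_sol c d (m - 1)"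

text \<open>Not yet divided by \<open>Q_det\<close>, so that its product with \<open>Q\<close> can
  be computed before \<open>Q_det\<close> is known to be nonzero.\<close>

definition green_mat :: "nat \<Rightarrow> real \<Rightarrow> real \<Rightarrow> real \<Rightarrow> real mat" where
  "green_mat m b c d = mat (Suc m) (Suc m) (\<lambda>(i,j). b^(i+j) * (boundary_sol c d (min i j) * boundary_sol c d (m - max i j)))"

text \<open>The recurrence makes the left side independent of \<open>k\<close>; at
  \<open>k = 0\<close> it is \<open>Q_det\<close>.\<close>

lemma boundary_sol_wronskian:
  assumes "k < m"
  shows "boundary_sol c d (Suc k) * boundary_sol c d (m - k) - boundary_sol c d k * boundary_sol c d (m - Suc k) = Q_det m c d"
  using assms
proof (induction k)
  case 0
  then show ?case by (simp add: Q_det_def)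
next
  case (Suc k)
  then have "m - k = Suc (Suc (m - Suc (Suc k)))" "m - Suc k = Suc (m - Suc (Suc k))" by auto
  then show ?case using Suc by (simp add: algebra_simps)
qed

lemma Q_mat_row_sum:
  assumes "i \<le> m"
  shows "(\<Sum>k<Suc m. Q_mat (Suc m) b c d $$ (i, k) * h k) =
    (if i = 0 \<or> i = m then d else c) * h i - (if i = 0 then 0 else b * h (i-1)) - (if i = m then 0 else b * h (Suc i))"
proof -
  have "(\<Sum>k<Suc m. Q_mat (Suc m) b c d $$ (i, k) * h k) =
    (\<Sum>k<Suc m. (if k = i then (if i = 0 \<or> i = m then d else c) * h i else 0)
      - (if k = i-1 then (if i = 0 then 0 else b * h (i-1)) else 0) - (if k = Suc i then b * h (Suc i) else 0))"
    using assms by (intro sum.cong) (auto simp: Q_mat_def)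
  then show ?thesis using assms by (auto simp: sum_subtractf simp del: sum.lessThan_Suc)
qed

text \<open>Up to powers of \<open>b\<close>, column \<open>j\<close> is a multiple of
  \<open>w k\<close> above the diagonal and of \<open>w (m - k)\<close> below it. Off the diagonal
  the recurrence and the boundary conditions give 0; on it the Wronskian appears.\<close>

lemma Q_mat_times_green_mat:
  assumes "m \<ge> 1" and b: "b * b = 1"
  shows "Q_mat (Suc m) b c d * green_mat m b c d = Q_det m c d \<cdot>\<^sub>m 1\<^sub>m (Suc m)"
proof (rule eq_matI)
  fix i j assume "i < dim_row (Q_det m c d \<cdot>\<^sub>m 1\<^sub>m (Suc m))" "j < dim_col (Q_det m c d \<cdot>\<^sub>m 1\<^sub>m (Suc m))"
  then have ij: "i \<le> m" "j \<le> m" by auto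
  define w where "w = boundary_sol c d"
  define h where "h k = w (min k j) * w (m - max k j)" for k
  have bb: "b * (b * z) = z" for z using b by (simp flip: mult.assoc)
  have w: "w 0 = 1" "w (Suc 0) = d" "\<And>k. w (Suc (Suc k)) = c * w (Suc k) - w k" by (simp_all add: w_def)
  have "(Q_mat (Suc m) b c d * green_mat m b c d) $$ (i,j) = (\<Sum>k<Suc m. Q_mat (Suc m) b c d $$ (i, k) * (b^(k+j) * h k))"
    using ij by (simp add: scalar_prod_def Q_mat_def green_mat_def h_def w_def lessThan_atLeast0 del: sum.op_ivl_Suc)
  \<comment> \<open>The off-diagonal \<open>b\<close> is absorbed:
    \<open>b * b^(i-1+j) = b^(i+j)\<close> for \<open>i > 0\<close>, and
    \<open>b * b^(Suc i+j) = b^(i+j)\<close> by \<open>b*b = 1\<close>.\<close>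
  also have "\<dots> = b^(i+j) * ((if i = 0 \<or> i = m then d else c) * h i - (if i = 0 then 0 else h (i-1)) - (if i = m then 0 else h (Suc i)))"
    unfolding Q_mat_row_sum[OF ij(1)] by (cases i) (auto simp: algebra_simps bb)
  also have "\<dots> = (if i = j then Q_det m c d else 0)"
  proof (rule linorder_cases[of i j])
    assume "i < j"
    then have "h i = w i * w (m-j)" "h (i-1) = w (i-1) * w (m-j)" "h (Suc i) = w (Suc i) * w (m-j)" "i \<noteq> m"
      using ij by (auto simp: h_def min_def max_def)
    then show ?thesis using \<open>i < j\<close> by (cases i) (auto simp: w algebra_simps)
  next
    assume "j < i"
    then have "min (i-1) j = j" "max (i-1) j = i - 1" "m - (i - 1) = Suc (m - i)" using ij by auto
    then have h: "h i = w j * w (m-i)" "h (i-1) = w j * w (Suc (m-i))" "h (Suc i) = w j * w (m - Suc i)" "i \<noteq> 0"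
      using \<open>j < i\<close> by (auto simp: h_def)
    show ?thesis
    proof (cases "i = m")
      case True
      then show ?thesis using h \<open>j < i\<close> by (simp add: w)
    next
      case False
      then have "m - i = Suc (m - Suc i)" using ij by auto
      then show ?thesis using h \<open>j < i\<close> False by (simp add: w algebra_simps)
    qed
  next
    assume "i = j"
    then have h: "h i = w i * w (m-i)" "h (Suc i) = w i * w (m - Suc i)" "i \<noteq> 0 \<Longrightarrow> h (i-1) = w (i-1) * w (m-i)"
      by (auto simp: h_def min_def max_def)
    have "b^(i+i) = 1" using b by (simp add: power_add flip: power_mult_distrib)
    moreover have "(if i = 0 \<or> i = m then d else c) * h i - (if i = 0 then 0 else h (i-1)) - (if i = m then 0 else h (Suc i)) = Q_det m c d"
    proof (cases "i = m")
      case True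
      then show ?thesis using h assms(1) by (simp add: Q_det_def w flip: w_def)
    next
      case False
      then have "w (Suc i) * w (m - i) - w i * w (m - Suc i) = Q_det m c d"
        unfolding w_def using ij by (intro boundary_sol_wronskian) auto
      then show ?thesis using h False by (cases i) (auto simp: w algebra_simps)
    qed
    ultimately show ?thesis using \<open>i = j\<close> by simp
  qed
  finally show "(Q_mat (Suc m) b c d * green_mat m b c d) $$ (i,j) = (Q_det m c d \<cdot>\<^sub>m 1\<^sub>m (Suc m)) $$ (i,j)"
    using ij by simp
qed (auto simp: Q_mat_def green_mat_def)

text \<open>The two-sided inverse makes \<open>A\<close> a unit of the matrix ring, which rules out
  the value \<open>None\<close> of \<open>mat_inverse\<close>.\<close>

lemma mat_inverse_of_invertible:
  fixes A :: "'a::field mat"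
  assumes A: "A \<in> carrier_mat n n" and "invertible_mat A"
  shows "the (mat_inverse A) \<in> carrier_mat n n" "the (mat_inverse A) * A = 1\<^sub>m n"
proof -
  obtain B where B: "A * B = 1\<^sub>m n" "B * A = 1\<^sub>m (dim_row B)"
    using assms unfolding invertible_mat_def inverts_mat_def by auto
  have "dim_col B = n" "dim_row B = n"
    using A arg_cong[OF B(1), of dim_col] arg_cong[OF B(2), of dim_col] by auto
  then have "A \<in> Units (ring_mat TYPE('a) n ())"
    using A B by (auto simp: Units_def ring_mat_def)
  then obtain B' where "mat_inverse A = Some B'" using mat_inverse(1)[OF A, of "()"] by (cases "mat_inverse A") auto
  then show "the (mat_inverse A) \<in> carrier_mat n n" "the (mat_inverse A) * A = 1\<^sub>m n"
    using mat_inverse(2)[OF A] by auto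
qed

lemma
  assumes m: "m \<ge> 1" and b: "b * b = 1" and inv: "invertible_mat (Q_mat (Suc m) b c d)"
  shows Q_det_nonzero: "Q_det m c d \<noteq> 0"
    and green_mat_eq_inverse: "green_mat m b c d = Q_det m c d \<cdot>\<^sub>m the (mat_inverse (Q_mat (Suc m) b c d))"
proof -
  let ?Q = "Q_mat (Suc m) b c d" and ?B = "the (mat_inverse (Q_mat (Suc m) b c d))"
  have Q: "?Q \<in> carrier_mat (Suc m) (Suc m)" and G: "green_mat m b c d \<in> carrier_mat (Suc m) (Suc m)"
    by (auto simp: Q_mat_def green_mat_def)
  note B = mat_inverse_of_invertible[OF Q inv]
  have "green_mat m b c d = (?B * ?Q) * green_mat m b c d" using B G by simp
  also have "\<dots> = ?B * (Q_det m c d \<cdot>\<^sub>m 1\<^sub>m (Suc m))"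
    using assoc_mult_mat[OF B(1) Q G] Q_mat_times_green_mat[OF m b] by simp
  also have "\<dots> = Q_det m c d \<cdot>\<^sub>m ?B"
    using mult_smult_distrib[OF B(1) one_carrier_mat] right_mult_one_mat[OF B(1)] by simp
  finally show eq: "green_mat m b c d = Q_det m c d \<cdot>\<^sub>m ?B" .
  \<comment> \<open>Both factors of this corner entry are \<open>boundary_sol c d 0 = 1\<close>; a
    nonzero entry of \<open>Q_det\<close> times a matrix forces \<open>Q_det\<close> to be
    nonzero.\<close>
  have "green_mat m b c d $$ (0, m) = b^m" by (simp add: green_mat_def)
  moreover have "b^m \<noteq> 0" using b by auto
  moreover have "(Q_det m c d \<cdot>\<^sub>m ?B) $$ (0, m) = Q_det m c d * ?B $$ (0, m)" using B(1) by auto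
  ultimately show "Q_det m c d \<noteq> 0" using eq by auto
qed

text \<open>The trace is the sum of \<open>B(i,j) * B(j,i)\<close>. The Green entries are symmetric
  in \<open>i\<close> and \<open>j\<close>, and their signs square to 1.\<close>

lemma trace_inverse_square:
  assumes m: "m \<ge> 1" and b: "b * b = 1" and inv: "invertible_mat (Q_mat (Suc m) b c d)"
  shows "(Q_det m c d)\<^sup>2 * mat_trace ((the (mat_inverse (Q_mat (Suc m) b c d))) ^\<^sub>m 2) =
    (\<Sum>i\<le>m. \<Sum>j\<le>m. (boundary_sol c d (min i j))\<^sup>2 * (boundary_sol c d (m - max i j))\<^sup>2)"
proof -
  let ?B = "the (mat_inverse (Q_mat (Suc m) b c d))" and ?D = "Q_det m c d"
  have "Q_mat (Suc m) b c d \<in> carrier_mat (Suc m) (Suc m)" by (auto simp: Q_mat_def)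
  note B = mat_inverse_of_invertible(1)[OF this inv]
  have entry: "?D * ?B $$ (i,j) = b^(i+j) * (boundary_sol c d (min i j) * boundary_sol c d (m - max i j))" if "i \<le> m" "j \<le> m" for i j
  proof -
    have "?D * ?B $$ (i,j) = (?D \<cdot>\<^sub>m ?B) $$ (i,j)" using B that by auto
    also have "\<dots> = green_mat m b c d $$ (i,j)" unfolding green_mat_eq_inverse[OF assms] ..
    finally show ?thesis using that by (simp add: green_mat_def)
  qed
  have bb: "b^(i+j) * b^(i+j) = 1" for i j using b by (simp flip: power_mult_distrib)
  have "mat_trace (?B ^\<^sub>m 2) = (\<Sum>i\<le>m. \<Sum>j\<le>m. ?B $$ (i,j) * ?B $$ (j,i))"
    using B by (auto simp: mat_trace_def numeral_2_eq_2 scalar_prod_def lessThan_Suc_atMost atLeast0AtMost atLeastLessThanSuc_atLeastAtMost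
       simp del: sum.op_ivl_Suc sum.lessThan_Suc intro!: sum.cong)
  then have "?D\<^sup>2 * mat_trace (?B ^\<^sub>m 2) = (\<Sum>i\<le>m. \<Sum>j\<le>m. (?D * ?B $$ (i,j)) * (?D * ?B $$ (j,i)))"
    by (simp add: sum_distrib_left power2_eq_square ac_simps)
  also have "\<dots> = (\<Sum>i\<le>m. \<Sum>j\<le>m. (boundary_sol c d (min i j))\<^sup>2 * (boundary_sol c d (m - max i j))\<^sup>2)"
  proof (intro sum.cong refl)
    fix i j assume "i \<in> {..m}" "j \<in> {..m}"
    then have "(?D * ?B $$ (i,j)) * (?D * ?B $$ (j,i)) = (b^(i+j) * b^(i+j)) * ((boundary_sol c d (min i j))\<^sup>2 * (boundary_sol c d (m - max i j))\<^sup>2)"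
      by (simp add: entry min.commute max.commute add.commute power2_eq_square ac_simps)
    then show "(?D * ?B $$ (i,j)) * (?D * ?B $$ (j,i)) = (boundary_sol c d (min i j))\<^sup>2 * (boundary_sol c d (m - max i j))\<^sup>2"
      unfolding bb by simp
  qed
  finally show ?thesis .
qed

section \<open>Closed forms in \<open>r_plus\<close> and \<open>r_minus\<close>, and the trace
  formula\<close>

lemma r_plus_times_r_minus: "r_plus c * r_minus c = 1"
proof -
  have "r_plus c * r_minus c = ((complex_of_real c)\<^sup>2 - (csqrt (complex_of_real (c\<^sup>2 - 4)))\<^sup>2) / 4"
    unfolding r_plus_def r_minus_def
    by (simp add: field_simps power2_eq_square del: power2_csqrt of_real_diff of_real_power)
  then show ?thesis by simp
qed

lemma r_plus_plus_r_minus: "r_plus c + r_minus c = complex_of_real c"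
  by (simp add: r_plus_def r_minus_def field_simps)

text \<open>\<open>r_plus c\<close> and \<open>r_minus c\<close> are the roots of
  \<open>z^2 - c*z + 1\<close>, so both sides satisfy the same recurrence; they agree at 0 and
  1.\<close>

lemma kappa0_boundary_sol:
  "kappa0 c lam * complex_of_real (boundary_sol c (c - lam) k) =
     phi_plus c lam * r_plus c ^ k - phi_minus c lam * r_minus c ^ k"
proof (induction c "c - lam" k rule: boundary_sol.induct)
  case (1 c)
  show ?case by (simp add: kappa0_def)
next
  case (2 c)
  have "complex_of_real (c - lam) = r_plus c + r_minus c - complex_of_real lam"
    by (simp add: r_plus_plus_r_minus)
  then show ?case by (simp add: kappa0_eq phi_plus_def phi_minus_def algebra_simps)
next
  case (3 c k)
  define x y where "x = r_plus c" and "y = r_minus c"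
  have xy: "x * (y * z) = z" for z using r_plus_times_r_minus[of c] by (simp add: x_def y_def flip: mult.assoc)
  have "kappa0 c lam * complex_of_real (boundary_sol c (c - lam) (Suc (Suc k))) =
     (x + y) * (kappa0 c lam * complex_of_real (boundary_sol c (c - lam) (Suc k)))
      - kappa0 c lam * complex_of_real (boundary_sol c (c - lam) k)"
    unfolding x_def y_def r_plus_plus_r_minus by (simp add: algebra_simps)
  also have "\<dots> = phi_plus c lam * x ^ Suc (Suc k) - phi_minus c lam * y ^ Suc (Suc k)"
    unfolding 3 x_def[symmetric] y_def[symmetric] by (simp add: algebra_simps xy)
  finally show ?case unfolding x_def y_def .
qed

text \<open>From \<open>x*y = 1\<close>, \<open>(x+y-L)*x^m - x^(m-1) = (x-L)*x^m\<close>, and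
  likewise for \<open>y\<close>; this supplies the second factor \<open>phi\<close> in
  \<open>kappa\<close>.\<close>

lemma kappa0_Q_det:
  assumes "m \<ge> 1"
  shows "kappa0 c lam * complex_of_real (Q_det m c (c - lam)) = kappa (Suc m) c lam"
proof -
  define x y L where "x = r_plus c" and "y = r_minus c" and "L = complex_of_real lam"
  have xy: "x * y = 1" using r_plus_times_r_minus[of c] by (simp add: x_def y_def)
  have xy': "x * (y * z) = z" for z using xy by (simp flip: mult.assoc)
  obtain k where k: "m = Suc k" using assms by (cases m) auto
  have "kappa0 c lam * complex_of_real (Q_det m c (c - lam)) = (x + y - L) * (kappa0 c lam * complex_of_real (boundary_sol c (c - lam) m))
     - kappa0 c lam * complex_of_real (boundary_sol c (c - lam) (m - 1))"
    unfolding x_def y_def r_plus_plus_r_minus Q_det_def L_def by (simp add: algebra_simps)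
  also have "\<dots> = kappa (Suc m) c lam"
    unfolding kappa0_boundary_sol kappa_def phi_plus_def phi_minus_def x_def[symmetric] y_def[symmetric] L_def[symmetric] k
    by (simp add: algebra_simps power2_eq_square xy xy')
  finally show ?thesis .
qed

theorem theorem4:
  fixes n :: nat and b c d lam :: real and Q :: "real mat"
  assumes "n \<ge> 2"
    and "b \<in> {1, -1}"
    and "c \<ge> 0"
    and "lam = c - d"
    and "lam \<noteq> 0"
    and "Q = Q_mat n b c d"
    and "invertible_mat Q"
    and "c \<noteq> 2"
  shows "complex_of_real (mat_trace ((the (mat_inverse Q)) ^\<^sub>m 2)) =
    inverse ((kappa0 c lam)\<^sup>2 * (kappa n c lam)\<^sup>2) * S_sum n c lam"
proof -
  obtain m where n: "n = Suc m" and m: "m \<ge> 1" using assms(1) by (cases n) auto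
  have d: "d = c - lam" and bb: "b * b = 1" using assms by auto
  have inv: "invertible_mat (Q_mat (Suc m) b c (c - lam))" using assms n d by simp
  define x y L k where "x = r_plus c" and "y = r_minus c" and "L = complex_of_real lam" and "k = kappa0 c lam"
  define u where "u i = (x - L) * x^i - (y - L) * y^i" for i
  define w where "w = boundary_sol c (c - lam)"
  define D where "D = complex_of_real (Q_det m c (c - lam))"
  define t where "t = complex_of_real (mat_trace ((the (mat_inverse Q)) ^\<^sub>m 2))"
  have xy: "x * y = 1" unfolding x_def y_def by (rule r_plus_times_r_minus)
  have k: "k = x - y" unfolding k_def x_def y_def by (rule kappa0_eq)
  have u: "u i = k * complex_of_real (w i)" for i
    by (simp add: kappa0_boundary_sol u_def k_def w_def x_def y_def L_def phi_plus_def phi_minus_def)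
  \<comment> \<open>\<open>k\<close> is a square root of \<open>c^2 - 4\<close>, and
    \<open>c \<ge> 0\<close> with \<open>c \<noteq> 2\<close> excludes
    \<open>c^2 = 4\<close>.\<close>
  have "c\<^sup>2 \<noteq> 2\<^sup>2" using assms by (subst power2_eq_iff_nonneg) auto
  then have "complex_of_real (c\<^sup>2 - 4) \<noteq> 0" by (subst of_real_eq_0_iff) simp
  moreover have "k = csqrt (complex_of_real (c\<^sup>2 - 4))"
    by (simp add: k x_def y_def r_plus_def r_minus_def field_simps)
  ultimately have k0: "k \<noteq> 0" by (metis csqrt_eq_0)
  have D0: "D \<noteq> 0" unfolding D_def using Q_det_nonzero[OF m bb inv] by simp
  have kappa: "kappa n c lam = k * D" using kappa0_Q_det[OF m] by (simp add: n k_def D_def)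
  have "D\<^sup>2 * t = complex_of_real (\<Sum>i\<le>m. \<Sum>j\<le>m. (w (min i j))\<^sup>2 * (w (m - max i j))\<^sup>2)"
    using trace_inverse_square[OF m bb inv] unfolding D_def t_def w_def assms(6) n d
    by (metis of_real_mult of_real_power)
  \<comment> \<open>Every summand has two squared values of \<open>w\<close>, and
    \<open>u = k * w\<close>.\<close>
  then have "k^4 * (D\<^sup>2 * t) = (\<Sum>i\<le>m. \<Sum>j\<le>m. (u (min i j))\<^sup>2 * (u (m - max i j))\<^sup>2)"
    by (simp add: u sum_distrib_left power4_eq_xxxx power2_eq_square ac_simps)
  then have "k^2 * (k^4 * (D\<^sup>2 * t)) = S_poly x y L (of_nat (Suc m)) (x^(2*m)) (y^(2*m))"
    using convolution_sum_closed_form[OF xy, of L m] unfolding sum_min_max_eq_convolutions[of "\<lambda>i. (u i)\<^sup>2"] by (simp add: k u_def)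
  also have "\<dots> = k^2 * S_sum n c lam"
  proof -
    have e: "2 * n - 2 = 2 * m" "2 * n - 1 = Suc (2 * m)" using n by auto
    have r: "rho c lam = (x - L) * (y - L)" by (simp add: rho_def x_def y_def L_def phi_plus_def phi_minus_def)
    have cc: "complex_of_real c = x + y" by (simp add: x_def y_def r_plus_plus_r_minus)
    \<comment> \<open>The only denominators in \<open>S_sum\<close> are \<open>k\<close> and
      \<open>k^2\<close>; clearing them with \<open>k^2\<close> gives \<open>S_poly\<close>.\<close>
    have clear: "k^2 * (a1 + p / k + a2 + q / k^2 - s / k^2 + z / k) = k^2 * (a1 + a2) + k * p + q - s + k * z"
      for a1 a2 p q s z using k0 by (simp add: field_simps power2_eq_square)
    show ?thesis
      unfolding S_sum_def Let_def S_poly_def e r cc phi_plus_def phi_minus_def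
        x_def[symmetric] y_def[symmetric] L_def[symmetric] k_def[symmetric] k[symmetric] n[symmetric] clear
      by (simp add: ac_simps)
  qed
  finally have "k^4 * (D\<^sup>2 * t) = S_sum n c lam" using k0 by (simp only: mult_cancel_left) simp
  then have "t = inverse (k^4 * D\<^sup>2) * S_sum n c lam" using k0 D0 by (simp add: field_simps)
  moreover have "k^4 * D\<^sup>2 = k\<^sup>2 * (k * D)\<^sup>2" by (simp add: power4_eq_xxxx power2_eq_square)
  ultimately show ?thesis unfolding t_def kappa k_def by simp
qed

end
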